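(* Suppose there exists a $3$-nice sequence of subsets of finite fields. Then for infinitely many positive integers $t$ we have $P(2^t-1)\ge (3/4)t^2$.
   Context: $P(m)$ denotes the largest prime factor of $m$. $\mathbb{F}_q$ is the finite field with $q$ elements and $\mathbb{F}_q^*$ its multiplicative group; $(u,v)=\sum_i u_iv_i$ is the dot product on $\mathbb{F}_q^m$. For a subset $S_1\subseteq\mathbb{F}_q$ and $\alpha,\beta\in\mathbb{F}_q$, $\alpha+\beta S_1=\{\alpha+\beta s: s\in S_1\}$. A set $S\subseteq\mathbb{F}_q^*$ is called $t$ combinatorially nice if for some constant $c>0$ and every positive integer $m$ there exist two collections of $n=\lfloor cm^t\rfloor$ vectors $u_1,\dots,u_n$ and $v_1,\dots,v_n$ in $\mathbb{F}_q^m$ such that $(u_i,v_i)=0$ for all $i\in[n]$ and $(u_j,v_i)\in S$ for all $i\ne j$ in $[n]$. A set $S\subseteq\mathbb{F}_q^*$ is called $k$ algebraically nice if $k$ is odd and there exist an odd $k'\le k$ and sets $S_0,S_1\subseteq\mathbb{F}_q$ such that $S_0\neq\emptyset$, $|S_1|=k'$, and for all $\alpha\in\mathbb{F}_q$ and $\beta\in S$ the number $|S_0\cap(\alpha+\beta S_1)|$ is even. A sequence $\{S_i\subseteq\mathbb{F}_{q_i}^*\}_{i\ge1}$ of subsets of finite fields is $k$-nice if every $S_i$ is $k$ algebraically nice and $t(i)$ combinatorially nice, for some integer-valued strictly increasing function $t$. *)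

theory Defs
  imports "HOL-Algebra.Algebra" "HOL-Computational_Algebra.Primes" Complex_Main
begin

(* Meaningful for m \<ge> 2 only: prime_factors 0 = prime_factors 1 = {}. *)
definition largest_prime_factor :: "nat \<Rightarrow> nat" where
  "largest_prime_factor m = Max (prime_factors m)"

(* A vector of length m over F is an extensional function on {1..m}. *)
definition vectors :: "('a, 'b) ring_scheme \<Rightarrow> nat \<Rightarrow> (nat \<Rightarrow> 'a) set" where
  "vectors F m = ({1..m} \<rightarrow>\<^sub>E carrier F)"

definition dot :: "('a, 'b) ring_scheme \<Rightarrow> nat \<Rightarrow> (nat \<Rightarrow> 'a) \<Rightarrow> (nat \<Rightarrow> 'a) \<Rightarrow> 'a" where
  "dot F m u v = (\<Oplus>\<^bsub>F\<^esub>l\<in>{1..m}. u l \<otimes>\<^bsub>F\<^esub> v l)"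

definition combinatorially_nice :: "('a, 'b) ring_scheme \<Rightarrow> real \<Rightarrow> 'a set \<Rightarrow> bool" where
  "combinatorially_nice F t S \<longleftrightarrow>
     S \<subseteq> carrier F - {\<zero>\<^bsub>F\<^esub>} \<and>
     (\<exists>c::real. c > 0 \<and>
       (\<forall>m::nat. m > 0 \<longrightarrow>
         (let n = nat \<lfloor>c * real m powr t\<rfloor> in
           \<exists>u v. (\<forall>i\<in>{1..n}. u i \<in> vectors F m \<and> v i \<in> vectors F m) \<and>
                 (\<forall>i\<in>{1..n}. dot F m (u i) (v i) = \<zero>\<^bsub>F\<^esub>) \<and>
                 (\<forall>i\<in>{1..n}. \<forall>j\<in>{1..n}. i \<noteq> j \<longrightarrow> dot F m (u j) (v i) \<in> S))))"

definition algebraically_nice :: "('a, 'b) ring_scheme \<Rightarrow> nat \<Rightarrow> 'a set \<Rightarrow> bool" where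
  "algebraically_nice F k S \<longleftrightarrow>
     S \<subseteq> carrier F - {\<zero>\<^bsub>F\<^esub>} \<and> odd k \<and>
     (\<exists>k' S\<^sub>0 S\<^sub>1. odd k' \<and> k' \<le> k \<and>
        S\<^sub>0 \<subseteq> carrier F \<and> S\<^sub>1 \<subseteq> carrier F \<and> S\<^sub>0 \<noteq> {} \<and> card S\<^sub>1 = k' \<and>
        (\<forall>\<alpha>\<in>carrier F. \<forall>\<beta>\<in>S.
           even (card (S\<^sub>0 \<inter> {\<alpha> \<oplus>\<^bsub>F\<^esub> \<beta> \<otimes>\<^bsub>F\<^esub> s |s. s \<in> S\<^sub>1}))))"

definition nice_sequence ::
    "nat \<Rightarrow> (nat \<Rightarrow> ('a, 'b) ring_scheme) \<Rightarrow> (nat \<Rightarrow> 'a set) \<Rightarrow> bool" where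
  "nice_sequence k F S \<longleftrightarrow>
     (\<forall>i\<ge>1. field (F i) \<and> finite (carrier (F i)) \<and>
            S i \<subseteq> carrier (F i) - {\<zero>\<^bsub>F i\<^esub>}) \<and>
     (\<exists>t :: nat \<Rightarrow> int. strict_mono_on {1..} t \<and>
        (\<forall>i\<ge>1. algebraically_nice (F i) k (S i) \<and>
                combinatorially_nice (F i) (real_of_int (t i)) (S i)))"

end

theory Submission
  imports Defs "HOL-Algebra.Algebraic_Closure_Type" "HOL-Library.Z2"
    "HOL-Number_Theory.Number_Theory"
begin

text \<open>
  Let \<open>K\<close> be an algebraic closure of the field with two elements. If \<open>S\<close> is algebraically nice
  for a finite field of characteristic \<open>p\<close>, the indicator function of \<open>S\<^sub>0\<close> is annihilated by the
  sums of translations over \<open>\<beta> S\<^sub>1\<close>; a common eigenvector of all translations in the space of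
  such functions is an additive character \<open>\<chi>\<close> with values in \<open>K\<close> and
  \<open>(\<Sum>s\<in>S\<^sub>1. \<chi> (\<beta> s)) = 0\<close> for all \<open>\<beta> \<in> S\<close>. With three terms this gives \<open>p\<close>-th roots of unity
  \<open>z \<noteq> 1\<close> and \<open>1 + z\<close> in \<open>K\<close>, and also an additive map \<open>l\<close> to the integers modulo \<open>p\<close> (a discrete
  logarithm of \<open>\<chi>\<close>) that vanishes nowhere on \<open>S\<close>.

  By the polynomial method, applied to the \<open>(p - 1)\<close>-th powers of the values of \<open>l\<close> on the dot
  products, combinatorial niceness with exponent \<open>t\<close> forces \<open>t < p\<close>, so \<open>p\<close> is unbounded along
  the sequence.

  Finally let \<open>t\<close> be the order of 2 modulo \<open>p\<close>, which is the degree of \<open>z\<close>. If the numerator and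
  the denominator of \<open>x ^ a * (1 + x) ^ b\<close>, \<open>(a, b) \<noteq> (0, 0)\<close>, have degree less than \<open>t\<close>, this
  rational function is not 1 at \<open>z\<close>. Hence the points of a hexagon of diameter less than \<open>t\<close>
  in the exponent lattice yield distinct \<open>p\<close>-th roots of unity, which gives \<open>p \<ge> (3/4) t\<^sup>2\<close>.
\<close>

section \<open>Characters from translation-invariant function spaces\<close>

text \<open>The polynomial \<open>P\<close> evaluated at the operator T of translation by
  \<open>g\<close>, then applied to \<open>f\<close>.\<close>

definition shift_poly ::
    "('a, 'b) monoid_scheme \<Rightarrow> 'a \<Rightarrow> 'k::comm_ring_1 poly \<Rightarrow> ('a \<Rightarrow> 'k) \<Rightarrow> 'a \<Rightarrow> 'k" where
  "shift_poly G g P f x = (\<Sum>i\<le>degree P. coeff P i * f (x \<otimes>\<^bsub>G\<^esub> g [^]\<^bsub>G\<^esub> i))"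

lemma shift_poly_altdef:
  assumes "degree P \<le> n"
  shows "shift_poly G g P f x = (\<Sum>i\<le>n. coeff P i * f (x \<otimes>\<^bsub>G\<^esub> g [^]\<^bsub>G\<^esub> i))"
  unfolding shift_poly_def using assms
  by (intro sum.mono_neutral_left) (auto simp: coeff_eq_0)

context comm_group
begin

text \<open>Evaluation at T is multiplicative in the polynomial, so the factor
  \<open>[:- z, 1:]\<close> acts as T - z.\<close>

lemma shift_poly_linear_factor:
  assumes "x \<in> carrier G" "g \<in> carrier G"
  shows "shift_poly G g ([:- z, 1:] * Q) f x =
           shift_poly G g Q f (x \<otimes> g) - z * shift_poly G g Q f x"
proof -
  have eq: "[:- z, 1:] * Q = pCons 0 Q - smult z Q"
    by simp
  have deg: "degree (pCons 0 Q - smult z Q) \<le> Suc (degree Q)"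
    by (intro degree_diff_le) (auto simp: degree_pCons_le intro: order_trans[OF degree_smult_le])
  have "shift_poly G g ([:- z, 1:] * Q) f x =
      (\<Sum>i\<le>Suc (degree Q). coeff (pCons 0 Q) i * f (x \<otimes> g [^] i)) -
      (\<Sum>i\<le>Suc (degree Q). z * coeff Q i * f (x \<otimes> g [^] i))"
    unfolding eq by (subst shift_poly_altdef[OF deg])
      (simp only: coeff_diff coeff_smult left_diff_distrib sum_subtractf)
  also have "(\<Sum>i\<le>Suc (degree Q). coeff (pCons 0 Q) i * f (x \<otimes> g [^] i)) =
      shift_poly G g Q f (x \<otimes> g)"
    unfolding shift_poly_def sum.atMost_Suc_shift using assms
    by (simp add: m_ac)
  also have "(\<Sum>i\<le>Suc (degree Q). z * coeff Q i * f (x \<otimes> g [^] i)) = z * shift_poly G g Q f x"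
    by (simp add: shift_poly_altdef[of Q "Suc (degree Q)"] sum_distrib_left mult.assoc
      del: sum.atMost_Suc)
  finally show ?thesis .
qed

text \<open>By Lagrange, translating \<open>card (carrier G)\<close> times by \<open>g\<close> is
  the identity. This supplies a nonzero annihilating polynomial from which eigenfunctions are
  extracted.\<close>

lemma shift_poly_order:
  fixes f :: "'a \<Rightarrow> 'k::comm_ring_1"
  assumes "finite (carrier G)" "x \<in> carrier G" "g \<in> carrier G"
  shows "shift_poly G g (monom 1 (card (carrier G)) - 1) f x = 0"
proof -
  have deg: "degree (monom 1 (card (carrier G)) - 1 :: 'k poly) \<le> card (carrier G)"
    by (intro degree_diff_le) (auto simp: degree_monom_le)
  have "f (x \<otimes> g [^] card (carrier G)) = f x"
    using assms by (simp add: pow_order_eq_1[unfolded Coset.order_def])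
  then show ?thesis
    using assms unfolding shift_poly_altdef[OF deg]
    by (simp add: left_diff_distrib sum_subtractf of_bool_def if_distrib[of "\<lambda>u. u * _"]
        cong: if_cong)
qed

text \<open>Strip roots off \<open>P\<close>. With P = (X - z) Q, either Q already annihilates
  \<open>f\<close> and has smaller degree, or Q(T) f is a nonzero eigenfunction for z.\<close>

lemma eigenfunction_step:
  fixes f :: "'a \<Rightarrow> 'k::alg_closed_field"
  assumes "\<And>f P. f \<in> W \<Longrightarrow> shift_poly G g P f \<in> W"
    and "g \<in> carrier G" "P \<noteq> 0" "f \<in> W" "\<exists>x\<in>carrier G. f x \<noteq> 0"
    and "\<forall>x\<in>carrier G. shift_poly G g P f x = 0"
  shows "\<exists>h\<in>W. (\<exists>x\<in>carrier G. h x \<noteq> 0) \<and> (\<exists>z. \<forall>x\<in>carrier G. h (x \<otimes> g) = z * h x)"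
  using assms(3,6)
proof (induction "degree P" arbitrary: P)
  case 0
  then obtain a where "P = [:a:]" "a \<noteq> 0"
    by (metis degree_eq_zeroE pCons_0_0)
  then show ?case
    using 0 assms(2,5) by (auto simp: shift_poly_def)
next
  case (Suc n)
  then obtain z where "poly P z = 0"
    using alg_closed_imp_poly_has_root[of P] by auto
  then obtain Q where P: "P = [:- z, 1:] * Q"
    by (metis poly_eq_0_iff_dvd dvdE)
  with Suc have "Q \<noteq> 0" by auto
  show ?case
  proof (cases "\<forall>x\<in>carrier G. shift_poly G g Q f x = 0")
    case True
    have "degree P = Suc (degree Q)"
      unfolding P using \<open>Q \<noteq> 0\<close> by (subst degree_mult_eq) auto
    then show ?thesis
      using Suc True \<open>Q \<noteq> 0\<close> by simp
  next
    case False
    have "\<forall>x\<in>carrier G. shift_poly G g Q f (x \<otimes> g) = z * shift_poly G g Q f x"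
      using Suc.prems(2) shift_poly_linear_factor[OF _ assms(2), of _ z Q f] unfolding P by auto
    then show ?thesis
      using False assms(1)[OF assms(4)] by blast
  qed
qed

text \<open>Commuting operators share an eigenvector. Group elements are treated one at a time: the
  common eigenfunctions of the earlier ones (\<open>W'\<close>) are preserved by polynomials in the
  next translation.\<close>

lemma common_eigenfunction:
  fixes f :: "'a \<Rightarrow> 'k::alg_closed_field"
  assumes fin: "finite (carrier G)"
    and closed: "\<And>f g P. f \<in> W \<Longrightarrow> g \<in> carrier G \<Longrightarrow> shift_poly G g P f \<in> W"
    and f: "f \<in> W" "\<exists>x\<in>carrier G. f x \<noteq> 0"
  shows "\<exists>h\<in>W. (\<exists>x\<in>carrier G. h x \<noteq> 0) \<and>
           (\<forall>g\<in>carrier G. \<exists>z. \<forall>x\<in>carrier G. h (x \<otimes> g) = z * h x)"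
proof -
  have "\<exists>h\<in>W. (\<exists>x\<in>carrier G. h x \<noteq> 0) \<and>
          (\<forall>g\<in>A. \<exists>z. \<forall>x\<in>carrier G. h (x \<otimes> g) = z * h x)"
    if "finite A" "A \<subseteq> carrier G" for A
    using that(1) that(2)
  proof (induction rule: finite_induct)
    case empty
    then show ?case using f by (intro bexI[of _ f]) auto
  next
    case (insert g A)
    then have g: "g \<in> carrier G" and A: "A \<subseteq> carrier G" by auto
    define W' where "W' = {h \<in> W. \<forall>a\<in>A. \<exists>z. \<forall>x\<in>carrier G. h (x \<otimes> a) = z * h x}"
    obtain h where h: "h \<in> W'" "\<exists>x\<in>carrier G. h x \<noteq> 0"
      using insert.IH[OF A] unfolding W'_def by auto
    have closed': "shift_poly G g P h \<in> W'" if "h \<in> W'" for h and P :: "'k poly"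
    proof -
      have "\<exists>z. \<forall>x\<in>carrier G. shift_poly G g P h (x \<otimes> a) = z * shift_poly G g P h x"
        if "a \<in> A" for a
      proof -
        have a: "a \<in> carrier G" using \<open>a \<in> A\<close> A by auto
        obtain z where z: "h (x \<otimes> a) = z * h x" if "x \<in> carrier G" for x
          using \<open>h \<in> W'\<close> \<open>a \<in> A\<close> unfolding W'_def by blast
        have "h (x \<otimes> a \<otimes> g [^] i) = z * h (x \<otimes> g [^] i)" if "x \<in> carrier G" for x and i :: nat
          using z[of "x \<otimes> g [^] i"] that a g by (simp add: m_ac)
        then show ?thesis
          by (intro exI[of _ z]) (simp add: shift_poly_def sum_distrib_left mult.left_commute)
      qed
      with that show ?thesis
        using closed g by (auto simp: W'_def)
    qed
    have nz: "monom 1 (card (carrier G)) - 1 \<noteq> (0 :: 'k poly)"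
    proof
      assume "monom 1 (card (carrier G)) - 1 = (0 :: 'k poly)"
      then have "degree (monom 1 (card (carrier G)) :: 'k poly) = degree (1 :: 'k poly)"
        by simp
      then show False
        using fin one_closed by (auto simp: degree_monom_eq card_eq_0_iff)
    qed
    have "\<exists>h\<in>W'. (\<exists>x\<in>carrier G. h x \<noteq> 0) \<and> (\<exists>z. \<forall>x\<in>carrier G. h (x \<otimes> g) = z * h x)"
      using closed' g nz h fin
      by (intro eigenfunction_step[of W' g "monom 1 (card (carrier G)) - 1" h]) (auto intro: shift_poly_order)
    then show ?case
      by (auto simp: W'_def)
  qed
  then show ?thesis
    using fin by blast
qed

text \<open>The functions whose sums over all translates of the given sets vanish form a
  translation-invariant space. A common eigenfunction \<open>h\<close> in it has eigenvalue
  \<open>h g / h \<one>\<close> for \<open>g\<close>, so \<open>h / h \<one>\<close> is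
  multiplicative; the untranslated sums give the last claim.\<close>

lemma character_annihilating:
  fixes f :: "'a \<Rightarrow> 'k::alg_closed_field"
  assumes fin: "finite (carrier G)"
    and sub: "\<And>B. B \<in> \<B> \<Longrightarrow> B \<subseteq> carrier G"
    and f: "\<exists>x\<in>carrier G. f x \<noteq> 0" "\<And>B x. B \<in> \<B> \<Longrightarrow> x \<in> carrier G \<Longrightarrow> (\<Sum>b\<in>B. f (x \<otimes> b)) = 0"
  obtains \<chi> :: "'a \<Rightarrow> 'k" where "\<chi> \<one> = 1"
    and "\<And>x y. x \<in> carrier G \<Longrightarrow> y \<in> carrier G \<Longrightarrow> \<chi> (x \<otimes> y) = \<chi> x * \<chi> y"
    and "\<And>B. B \<in> \<B> \<Longrightarrow> (\<Sum>b\<in>B. \<chi> b) = 0"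
proof -
  define W where "W = {f :: 'a \<Rightarrow> 'k. \<forall>B\<in>\<B>. \<forall>x\<in>carrier G. (\<Sum>b\<in>B. f (x \<otimes> b)) = 0}"
  have "shift_poly G g P h \<in> W" if "h \<in> W" "g \<in> carrier G" for h g P
  proof -
    have "(\<Sum>b\<in>B. shift_poly G g P h (x \<otimes> b)) = 0" if "B \<in> \<B>" "x \<in> carrier G" for B x
    proof -
      have "(\<Sum>b\<in>B. shift_poly G g P h (x \<otimes> b)) =
          (\<Sum>i\<le>degree P. \<Sum>b\<in>B. coeff P i * h (x \<otimes> b \<otimes> g [^] i))"
        unfolding shift_poly_def by (rule sum.swap)
      also have "\<dots> = (\<Sum>i\<le>degree P. coeff P i * (\<Sum>b\<in>B. h (x \<otimes> g [^] i \<otimes> b)))"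
        using sub[OF \<open>B \<in> \<B>\<close>] \<open>x \<in> carrier G\<close> \<open>g \<in> carrier G\<close>
        by (auto simp: sum_distrib_left m_ac intro!: sum.cong arg_cong[of _ _ h])
      also have "\<dots> = 0"
        using \<open>h \<in> W\<close> \<open>g \<in> carrier G\<close> that by (simp add: W_def)
      finally show ?thesis .
    qed
    then show ?thesis by (simp add: W_def)
  qed
  moreover have "f \<in> W" using f by (simp add: W_def)
  ultimately obtain h where "h \<in> W" "\<exists>x\<in>carrier G. h x \<noteq> 0"
    and eig: "\<forall>g\<in>carrier G. \<exists>z. \<forall>x\<in>carrier G. h (x \<otimes> g) = z * h x"
    using common_eigenfunction[OF fin, of W f] f(1) by blast
  \<comment> \<open>Every \<open>h x\<close> is a multiple of \<open>h \<one>\<close>, so a zero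
    there would make \<open>h\<close> vanish on the whole group.\<close>
  have one: "h \<one> \<noteq> 0"
    using eig \<open>\<exists>x\<in>carrier G. h x \<noteq> 0\<close> by (metis l_one mult_zero_right one_closed)
  have h: "h (x \<otimes> g) * h \<one> = h g * h x" if "x \<in> carrier G" "g \<in> carrier G" for x g
  proof -
    obtain z where z: "\<And>x. x \<in> carrier G \<Longrightarrow> h (x \<otimes> g) = z * h x"
      using eig \<open>g \<in> carrier G\<close> by blast
    show ?thesis using z[of x] z[of \<one>] that by simp
  qed
  show thesis
  proof (rule that[of "\<lambda>x. h x / h \<one>"])
    show "h (x \<otimes> y) / h \<one> = h x / h \<one> * (h y / h \<one>)" if "x \<in> carrier G" "y \<in> carrier G" for x y
      using h[OF that] one by (simp add: field_simps)
    show "(\<Sum>b\<in>B. h b / h \<one>) = 0" if "B \<in> \<B>" for B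
    proof -
      have "(\<Sum>b\<in>B. h (\<one> \<otimes> b)) = 0"
        using \<open>h \<in> W\<close> \<open>B \<in> \<B>\<close> by (simp add: W_def)
      moreover have "(\<Sum>b\<in>B. h (\<one> \<otimes> b)) = (\<Sum>b\<in>B. h b)"
        using sub[OF that] by (intro sum.cong) auto
      ultimately show ?thesis
        by (simp flip: sum_divide_distrib)
    qed
  qed (use one in auto)
qed

end

section \<open>A bound for matching vectors\<close>

text \<open>
  The rank bound for the identity matrix modulo \<open>p\<close>, proved by counting vectors modulo \<open>p\<close>, so
  that no linear algebra over the prime field is needed.
\<close>

lemma identity_factorization_card:
  fixes A :: "nat \<Rightarrow> 'r \<Rightarrow> int" and B :: "'r \<Rightarrow> nat \<Rightarrow> int" and p :: nat
  assumes "finite R" "p > 1"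
    and id: "\<And>i j. i \<in> {1..n} \<Longrightarrow> j \<in> {1..n} \<Longrightarrow>
               [(\<Sum>r\<in>R. A j r * B r i) = of_bool (i = j)] (mod int p)"
  shows "n \<le> card R"
proof -
  define U where "U = {1..n} \<rightarrow>\<^sub>E {0..<int p}"
  define V where "V = R \<rightarrow>\<^sub>E {0..<int p}"
  \<comment> \<open>Multiplication of a vector by \<open>A\<close> modulo \<open>p\<close>.
    Multiplying further by \<open>B\<close> recovers the vector, so this map is injective.\<close>
  define \<phi> where "\<phi> = (\<lambda>x. \<lambda>r\<in>R. (\<Sum>j=1..n. x j * A j r) mod int p)"
  have "inj_on \<phi> U"
  proof (rule inj_onI)
    fix x y assume xy: "x \<in> U" "y \<in> U" "\<phi> x = \<phi> y"
    have cong: "[(\<Sum>r\<in>R. \<phi> x r * B r i) = x i] (mod int p)" if i: "i \<in> {1..n}" for x i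
    proof -
      have "[(\<Sum>r\<in>R. \<phi> x r * B r i) = (\<Sum>r\<in>R. (\<Sum>j=1..n. x j * A j r) * B r i)] (mod int p)"
        by (intro cong_sum cong_mult) (auto simp: \<phi>_def cong_def)
      also have "(\<Sum>r\<in>R. (\<Sum>j=1..n. x j * A j r) * B r i) =
          (\<Sum>j=1..n. x j * (\<Sum>r\<in>R. A j r * B r i))"
        unfolding sum_distrib_right sum_distrib_left by (subst sum.swap) (simp add: mult.assoc)
      also have "[(\<Sum>j=1..n. x j * (\<Sum>r\<in>R. A j r * B r i)) =
          (\<Sum>j=1..n. x j * of_bool (i = j))] (mod int p)"
        using i by (intro cong_sum cong_mult id) auto
      also have "(\<Sum>j=1..n. x j * of_bool (i = j)) = x i"
        using i by (simp add: of_bool_def if_distrib cong: if_cong)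
      finally show ?thesis .
    qed
    have "x i = y i" if i: "i \<in> {1..n}" for i
    proof -
      have "[x i = y i] (mod int p)"
        using cong[OF i, of x] cong[OF i, of y] xy(3) by (metis cong_sym cong_trans)
      moreover have "x i \<in> {0..<int p}" "y i \<in> {0..<int p}"
        using xy i by (auto simp: U_def PiE_iff)
      ultimately show ?thesis
        by (simp add: cong_def)
    qed
    then show "x = y"
      using xy by (intro PiE_ext[of x "{1..n}" "\<lambda>_. {0..<int p}" y]) (auto simp: U_def)
  qed
  moreover have "\<phi> ` U \<subseteq> V"
    using \<open>p > 1\<close> by (auto simp: \<phi>_def V_def)
  moreover have "finite V"
    using \<open>finite R\<close> by (auto simp: V_def intro: finite_PiE)
  ultimately have "card U \<le> card V"
    by (rule card_inj_on_le)
  then have "p ^ n \<le> p ^ card R"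
    using \<open>finite R\<close> by (simp add: U_def V_def card_PiE)
  then show ?thesis
    using \<open>p > 1\<close> by simp
qed

lemma fermat_int:
  fixes a :: int
  assumes "Factorial_Ring.prime p" "\<not> int p dvd a"
  shows "[a ^ (p - 1) = 1] (mod int p)"
proof -
  define b where "b = nat (a mod int p)"
  have b: "int b = a mod int p"
    using assms(1) prime_gt_0_nat by (simp add: b_def)
  then have "\<not> p dvd b"
    using assms(2) by (metis dvd_mod_iff dvd_refl int_dvd_int_iff)
  then have "[int b ^ (p - 1) = 1] (mod int p)"
    using fermat_theorem[OF assms(1)] by (metis cong_int_iff of_nat_1 of_nat_power)
  moreover have "[int b ^ (p - 1) = a ^ (p - 1)] (mod int p)"
    by (intro cong_pow) (simp add: b cong_def)
  ultimately show ?thesis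
    by (metis cong_sym cong_trans)
qed

text \<open>Distributing the power separates the factors \<open>a\<close> from the factors
  \<open>b\<close>. Thus the entrywise \<open>k\<close>-th power of a matrix factoring through
  \<open>R\<close> factors through \<open>k\<close>-tuples over \<open>R\<close>.\<close>

lemma sum_mult_power:
  fixes a b :: "'r \<Rightarrow> 'c::comm_semiring_1"
  assumes "finite R"
  shows "(\<Sum>r\<in>R. a r * b r) ^ k =
           (\<Sum>s\<in>{..<k} \<rightarrow>\<^sub>E R. (\<Prod>i<k. a (s i)) * (\<Prod>i<k. b (s i)))"
  using prod_sum_PiE[of "{..<k}" "\<lambda>_. R" "\<lambda>_ r. a r * b r"] assms
  by (simp add: prod.distrib)

context ring
begin

lemma additive_cong_finsum:
  fixes l :: "'a \<Rightarrow> int" and N :: int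
  assumes add: "\<And>x y. x \<in> carrier R \<Longrightarrow> y \<in> carrier R \<Longrightarrow> [l (x \<oplus> y) = l x + l y] (mod N)"
    and "finite A" "f \<in> A \<rightarrow> carrier R"
  shows "[l (\<Oplus>i\<in>A. f i) = (\<Sum>i\<in>A. l (f i))] (mod N)"
  using assms(2,3)
proof (induction rule: finite_induct)
  case empty
  have "[l \<zero> = l \<zero> + l \<zero>] (mod N)"
    using add[of \<zero> \<zero>] by simp
  then show ?case
    by (simp add: cong_iff_dvd_diff)
next
  case (insert i A)
  then have "[l (f i \<oplus> (\<Oplus>i\<in>A. f i)) = l (f i) + l (\<Oplus>i\<in>A. f i)] (mod N)"
    by (intro add) auto
  moreover have "[l (f i) + l (\<Oplus>i\<in>A. f i) = l (f i) + (\<Sum>i\<in>A. l (f i))] (mod N)"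
    using insert by (intro cong_add) auto
  ultimately have "[l (f i \<oplus> (\<Oplus>i\<in>A. f i)) = l (f i) + (\<Sum>i\<in>A. l (f i))] (mod N)"
    by (rule cong_trans)
  then show ?case
    using insert by auto
qed

text \<open>
  Each product \<open>l (u\<^sub>k \<otimes> v\<^sub>k)\<close> is expanded over the possible values \<open>g\<close> of \<open>u\<^sub>k\<close>. This replaces
  coordinates over the prime field, at the cost of a factor \<open>card (carrier R)\<close>.
\<close>

lemma matching_vectors_bound:
  fixes l :: "'a \<Rightarrow> int" and p m n :: nat
  assumes fin: "finite (carrier R)" and p: "Factorial_Ring.prime p"
    and add: "\<And>x y. x \<in> carrier R \<Longrightarrow> y \<in> carrier R \<Longrightarrow> [l (x \<oplus> y) = l x + l y] (mod int p)"
    and vec: "\<And>i. i \<in> {1..n} \<Longrightarrow> u i \<in> vectors R m \<and> v i \<in> vectors R m"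
    and diag: "\<And>i. i \<in> {1..n} \<Longrightarrow> int p dvd l (dot R m (u i) (v i))"
    and off: "\<And>i j. i \<in> {1..n} \<Longrightarrow> j \<in> {1..n} \<Longrightarrow> i \<noteq> j \<Longrightarrow>
                \<not> int p dvd l (dot R m (u j) (v i))"
  shows "n \<le> Suc ((m * card (carrier R)) ^ (p - 1))"
proof -
  define I where "I = {1..m} \<times> carrier R"
  define a where "a j = (\<lambda>(k, g). of_bool (u j k = g) :: int)" for j
  define b where "b i = (\<lambda>(k, g). l (g \<otimes> v i k))" for i
  define L where "L j i = (\<Sum>r\<in>I. a j r * b i r)" for i j
  \<comment> \<open>Index set for a factorization of 1 - L^(p-1): \<open>None\<close> carries the
    constant 1, each \<open>Some s\<close> one product of the expanded power, with its minus sign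
    put into \<open>B\<close>.\<close>
  define J where "J = insert None (Some ` ({..<p - 1} \<rightarrow>\<^sub>E I))"
  define A where "A j s = (case s of None \<Rightarrow> 1 | Some s \<Rightarrow> (\<Prod>k<p - 1. a j (s k)))" for j s
  define B where "B s i = (case s of None \<Rightarrow> 1 | Some s \<Rightarrow> - (\<Prod>k<p - 1. b i (s k)))" for s i
  have "finite I"
    using fin by (simp add: I_def)
  then have finJ: "finite ({..<p - 1} \<rightarrow>\<^sub>E I)"
    by (intro finite_PiE) auto
  have L: "[l (dot R m (u j) (v i)) = L j i] (mod int p)" if "i \<in> {1..n}" "j \<in> {1..n}" for i j
  proof -
    have carr: "u j k \<in> carrier R" "v i k \<in> carrier R" if "k \<in> {1..m}" for k
      using vec[OF \<open>i \<in> {1..n}\<close>] vec[OF \<open>j \<in> {1..n}\<close>] that by (auto simp: vectors_def PiE_iff)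
    have "[l (dot R m (u j) (v i)) = (\<Sum>k\<in>{1..m}. l (u j k \<otimes> v i k))] (mod int p)"
      unfolding dot_def using carr by (intro additive_cong_finsum add) auto
    also have "(\<Sum>k\<in>{1..m}. l (u j k \<otimes> v i k)) =
        (\<Sum>k\<in>{1..m}. \<Sum>g\<in>carrier R. of_bool (u j k = g) * l (g \<otimes> v i k))"
      using carr fin by (intro sum.cong) (auto simp: of_bool_def if_distrib[of "\<lambda>y. y * _"] cong: if_cong)
    also have "\<dots> = L j i"
      by (simp only: L_def I_def a_def b_def sum.cartesian_product case_prod_unfold)
    finally show ?thesis .
  qed
  have AB: "(\<Sum>s\<in>J. A j s * B s i) = 1 - L j i ^ (p - 1)" for i j
  proof -
    have "(\<Sum>s\<in>J. A j s * B s i) =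
        1 + (\<Sum>s\<in>{..<p - 1} \<rightarrow>\<^sub>E I. A j (Some s) * B (Some s) i)"
      using finJ unfolding J_def by (subst sum.insert) (auto simp: A_def B_def sum.reindex)
    also have "\<dots> = 1 - L j i ^ (p - 1)"
      using sum_mult_power[OF \<open>finite I\<close>, of "a j" "b i" "p - 1"]
      by (simp add: A_def B_def L_def sum_negf)
    finally show ?thesis .
  qed
  \<comment> \<open>By Fermat, 1 - L^(p-1) is 1 modulo \<open>p\<close> where \<open>p\<close>
    divides L and 0 elsewhere, so \<open>diag\<close> and \<open>off\<close> make it the identity
    matrix.\<close>
  have "n \<le> card J"
  proof (rule identity_factorization_card)
    show "finite J" "p > 1"
      using finJ p prime_gt_1_nat by (auto simp: J_def)
    show "[(\<Sum>s\<in>J. A j s * B s i) = of_bool (i = j)] (mod int p)"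
      if "i \<in> {1..n}" "j \<in> {1..n}" for i j
    proof (cases "i = j")
      case True
      then have "int p dvd L j i"
        using L[OF that] diag[OF that(1)] by (metis cong_dvd_iff)
      then have "int p dvd L j i ^ (p - 1)"
        using \<open>p > 1\<close> by (simp add: dvd_power_iff_le dvd_trans dvd_power)
      then show ?thesis
        using True by (simp add: AB cong_iff_dvd_diff)
    next
      case False
      then have "\<not> int p dvd L j i"
        using L[OF that] off[OF that] by (metis cong_dvd_iff)
      then show ?thesis
        using False fermat_int[OF p, of "L j i"] by (simp add: AB cong_iff_dvd_diff dvd_diff_commute)
    qed
  qed
  also have "card J = Suc ((m * card (carrier R)) ^ (p - 1))"
    using finJ by (simp add: J_def card_image card_PiE I_def card_cartesian_product)
  finally show ?thesis .
qed

end

section \<open>Three-term relations between roots of unity\<close>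

lemma prime_root_of_unity_power_eq_1_iff:
  fixes z :: "'k::field"
  assumes "Factorial_Ring.prime p" "z ^ p = 1" "z \<noteq> 1"
  shows "z ^ k = 1 \<longleftrightarrow> p dvd k"
proof
  assume "z ^ k = 1"
  show "p dvd k"
  proof (rule ccontr)
    assume "\<not> p dvd k"
    then have "coprime k p"
      using assms(1) by (metis coprime_commute prime_imp_coprime)
    then obtain x where "[k * x = 1] (mod p)"
      using cong_solve_coprime_nat by auto
    then have "k * x mod p = 1"
      using prime_gt_1_nat[OF assms(1)] by (simp add: cong_def)
    then have "k * x = p * (k * x div p) + 1"
      by (metis mult_div_mod_eq)
    then have "z ^ (k * x) = (z ^ p) ^ (k * x div p) * z"
      by (metis power_add power_mult power_one_right)
    then show False
      using assms \<open>z ^ k = 1\<close> by (simp add: power_mult)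
  qed
next
  assume "p dvd k"
  then show "z ^ k = 1"
    using assms by (auto simp: power_mult)
qed

lemma prime_root_of_unity_power_eq_iff:
  fixes z :: "'k::field"
  assumes "Factorial_Ring.prime p" "z ^ p = 1" "z \<noteq> 1"
  shows "z ^ j = z ^ k \<longleftrightarrow> [j = k] (mod p)"
proof -
  have "z \<noteq> 0"
    using assms(2) prime_gt_0_nat[OF assms(1)] by (auto simp: power_0_left)
  have *: "z ^ j = z ^ k \<longleftrightarrow> [j = k] (mod p)" if "k \<le> j" for j k :: nat
  proof -
    have "z ^ j = z ^ k * z ^ (j - k)"
      using that by (simp flip: power_add)
    then have "z ^ j = z ^ k \<longleftrightarrow> z ^ (j - k) = 1"
      using \<open>z \<noteq> 0\<close> by simp
    then show ?thesis
      using that by (simp add: prime_root_of_unity_power_eq_1_iff[OF assms] cong_altdef_nat)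
  qed
  show ?thesis
    using *[of j k] *[of k j] by (metis cong_sym nle_le)
qed

lemma roots_of_unity_card:
  assumes "p > 0"
  shows "finite {y :: 'k::field. y ^ p = 1}" "card {y :: 'k::field. y ^ p = 1} \<le> p"
proof -
  define P where "P = monom 1 p - (1 :: 'k poly)"
  have "coeff P p = 1"
    using assms by (simp add: P_def)
  then have "P \<noteq> 0"
    by auto
  moreover have "{y. poly P y = 0} = {y. y ^ p = 1}"
    by (simp add: P_def poly_monom)
  moreover have "degree P \<le> p"
    unfolding P_def by (intro degree_diff_le) (auto simp: degree_monom_le)
  ultimately show "finite {y :: 'k. y ^ p = 1}" "card {y :: 'k. y ^ p = 1} \<le> p"
    using poly_roots_finite[of P] card_poly_roots_bound[of P] by auto
qed

text \<open>The powers of \<open>z\<close> with exponent below \<open>p\<close> are \<open>p\<close>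
  distinct roots of unity, and there are at most \<open>p\<close> of these.\<close>

lemma prime_root_of_unity_generates:
  fixes z :: "'k::field"
  assumes z: "Factorial_Ring.prime p" "z ^ p = 1" "z \<noteq> 1" and "y ^ p = 1"
  shows "\<exists>k. y = z ^ k"
proof -
  have "p > 0"
    using z(1) prime_gt_0_nat by blast
  have "inj_on (\<lambda>k. z ^ k) {..<p}"
    using prime_root_of_unity_power_eq_iff[OF z] by (auto simp: inj_on_def cong_def)
  then have "card ((\<lambda>k. z ^ k) ` {..<p}) = p"
    by (simp add: card_image)
  moreover have "(\<lambda>k. z ^ k) ` {..<p} \<subseteq> {y. y ^ p = 1}"
    using z(2) by (auto simp flip: power_mult) (metis mult.commute power_mult power_one)
  ultimately have "(\<lambda>k. z ^ k) ` {..<p} = {y. y ^ p = 1}"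
    using roots_of_unity_card[OF \<open>p > 0\<close>] by (metis card_seteq)
  then show ?thesis
    using assms(4) by blast
qed

text \<open>The roots \<open>z ^ 2 ^ i\<close> for \<open>i < ord p 2\<close> are distinct.\<close>

lemma poly_frobenius_root_eq_0:
  fixes z :: "'k::field" and f :: "'k poly"
  assumes z: "Factorial_Ring.prime p" "z ^ p = 1" "z \<noteq> 1" and "odd p"
    and frob: "\<And>x. poly f (x\<^sup>2) = (poly f x)\<^sup>2"
    and "poly f z = 0" "degree f < Pocklington.ord p 2"
  shows "f = 0"
proof (rule ccontr)
  assume "f \<noteq> 0"
  define t where "t = Pocklington.ord p 2"
  have cop: "coprime p 2"
    using \<open>odd p\<close> by simp
  \<comment> \<open>The hypothesis \<open>frob\<close> stands in for coefficients in the field with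
    two elements; it carries the root \<open>z\<close> to all its repeated squares.\<close>
  have root: "poly f (z ^ 2 ^ i) = 0" for i
  proof (induction i)
    case (Suc i)
    have "z ^ 2 ^ Suc i = (z ^ 2 ^ i)\<^sup>2"
      by (simp add: mult.commute flip: power_mult)
    then show ?case
      using Suc frob by simp
  qed (use assms in simp)
  have "inj_on (\<lambda>i. z ^ 2 ^ i) {..<t}"
    unfolding inj_on_def
    using prime_root_of_unity_power_eq_iff[OF z] order_divides_expdiff[OF cop]
    by (auto simp: cong_def t_def)
  then have "t = card ((\<lambda>i. z ^ 2 ^ i) ` {..<t})"
    by (simp add: card_image)
  also have "\<dots> \<le> card {x. poly f x = 0}"
    using root poly_roots_finite[OF \<open>f \<noteq> 0\<close>] by (intro card_mono) auto
  also have "\<dots> \<le> degree f"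
    by (rule card_poly_roots_bound[OF \<open>f \<noteq> 0\<close>])
  finally show False
    using assms(7) by (simp add: t_def)
qed

section \<open>Multiplicative independence in characteristic 2\<close>

lemma char_2_power2_add:
  fixes x y :: "'k::comm_ring_1"
  assumes "CHAR('k) = 2"
  shows "(x + y)\<^sup>2 = x\<^sup>2 + y\<^sup>2"
  using freshmans_dream[of 2 x y] assms two_is_prime_nat by metis

lemma char_2_power2_diff:
  fixes x y :: "'k::comm_ring_1"
  assumes "CHAR('k) = 2"
  shows "(x - y)\<^sup>2 = x\<^sup>2 - y\<^sup>2"
  using char_2_power2_add[OF assms, of x "- y"] uminus_CHAR_2[OF assms, of "y\<^sup>2"]
  by (metis diff_conv_add_uminus power2_minus)

text \<open>The difference of the two sides of \<open>eq\<close> is a polynomial in \<open>z\<close>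
  that commutes with squaring and has degree below the order of 2, so it is the zero polynomial. Its
  values at 0 and 1 then determine the exponents.\<close>

lemma multiplicative_independence:
  fixes z :: "'k::field"
  assumes z: "Factorial_Ring.prime p" "z ^ p = 1" "z \<noteq> 1" "odd p" "CHAR('k) = 2"
    and deg: "a + b < Pocklington.ord p 2" "c + d < Pocklington.ord p 2"
    and red: "a = 0 \<or> c = 0" "b = 0 \<or> d = 0"
    and eq: "z ^ a * (1 + z) ^ b = z ^ c * (1 + z) ^ d"
  shows "a = c \<and> b = d"
proof -
  define f where "f = monom 1 a * [:1, 1:] ^ b - monom 1 c * [:1, 1 :: 'k:] ^ d"
  have pf: "poly f x = x ^ a * (1 + x) ^ b - x ^ c * (1 + x) ^ d" for x
    by (simp add: f_def poly_monom)
  have degM: "degree (monom 1 i * [:1, 1 :: 'k:] ^ j) \<le> i + j" for i j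
  proof -
    have "degree (monom 1 i * [:1, 1 :: 'k:] ^ j) \<le>
        degree (monom (1 :: 'k) i) + degree ([:1, 1 :: 'k:] ^ j)"
      by (rule degree_mult_le)
    then show ?thesis
      by (simp add: degree_monom_eq degree_linear_power)
  qed
  have "degree f \<le> max (a + b) (c + d)"
    unfolding f_def using degM[of a b] degM[of c d] by (intro degree_diff_le) auto
  then have "degree f < Pocklington.ord p 2"
    using deg by simp
  moreover have "poly f (x\<^sup>2) = (poly f x)\<^sup>2" for x
  proof -
    have "1 + x\<^sup>2 = (1 + x)\<^sup>2"
      using char_2_power2_add[OF z(5), of 1 x] by simp
    then show ?thesis
      by (simp add: pf char_2_power2_diff[OF z(5)] power_mult_distrib mult.commute flip: power_mult)
  qed
  moreover have "poly f z = 0"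
    using eq by (simp add: pf)
  ultimately have "f = 0"
    using z by (intro poly_frobenius_root_eq_0[of p z f])
  \<comment> \<open>Since \<open>0 ^ 0 = 1\<close>, this says that \<open>a\<close> and
    \<open>c\<close> vanish together, so by \<open>red\<close> both are 0. The value at 1, the root
    of 1 + x in characteristic 2, does the same for \<open>b\<close> and \<open>d\<close>.\<close>
  have at0: "0 ^ a = (0 ^ c :: 'k)"
    using pf[of 0] \<open>f = 0\<close> by simp
  have at1: "0 ^ b = (0 ^ d :: 'k)"
  proof -
    have "1 + 1 = (0 :: 'k)"
      using uminus_CHAR_2[OF z(5), of 1] by (metis add.right_inverse)
    then show ?thesis
      using pf[of 1] \<open>f = 0\<close> by simp
  qed
  show ?thesis
    using at0 at1 red by (auto simp: power_0_left split: if_splits)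
qed

section \<open>Counting lattice points of a hexagon\<close>

text \<open>
  The points \<open>(a, b)\<close> with \<open>a, b < t\<close> and \<open>t div 2 \<le> a + b < t div 2 + t\<close>: the differences of
  \<open>a\<close>, of \<open>b\<close> and of \<open>a + b\<close> between two of them are all less than \<open>t\<close> in absolute value.
\<close>

definition hexagon :: "nat \<Rightarrow> (nat \<times> nat) set" where
  "hexagon t = (SIGMA a:{..<t}. {t div 2 - a..<min t (t div 2 + t - a)})"

lemma sum_lessThan_add:
  fixes g :: "nat \<Rightarrow> 'c::comm_monoid_add"
  shows "sum g {..<m + n} = sum g {..<m} + (\<Sum>i<n. g (m + i))"
  by (induction n) (simp_all add: add.assoc)

text \<open>Columns \<open>a\<close> and \<open>L + a\<close> together have constant height,
  \<open>3 * L\<close> or \<open>3 * L + 2\<close> according to the parity of \<open>t\<close>; for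
  odd \<open>t\<close> the last column adds \<open>L + 1\<close>.\<close>

lemma card_hexagon: "4 * card (hexagon t) \<ge> 3 * t\<^sup>2"
proof -
  define L where "L = t div 2"
  define g where "g a = min t (L + t - a) - (L - a)" for a
  have card: "card (hexagon t) = (\<Sum>a<t. g a)"
    by (simp add: hexagon_def g_def L_def)
  show ?thesis
  proof (cases "even t")
    case True
    then have t: "t = L + L"
      unfolding L_def by presburger
    have "(\<Sum>a<t. g a) = (\<Sum>a<L. g a + g (L + a))"
      unfolding t sum_lessThan_add sum.distrib ..
    also have "\<dots> = (\<Sum>a<L. 3 * L)"
      by (intro sum.cong) (auto simp: g_def t)
    finally show ?thesis
      unfolding card by (simp add: t power2_eq_square algebra_simps)
  next
    case False
    then have t: "t = L + Suc L"
      unfolding L_def by presburger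
    have "(\<Sum>a<t. g a) = (\<Sum>a<L. g a + g (L + a)) + g (L + L)"
      unfolding t sum_lessThan_add sum.distrib sum.lessThan_Suc by simp
    also have "(\<Sum>a<L. g a + g (L + a)) = (\<Sum>a<L. 3 * L + 2)"
      by (intro sum.cong) (auto simp: g_def t)
    also have "g (L + L) = L + 1"
      by (simp add: g_def t)
    finally show ?thesis
      unfolding card by (simp add: t power2_eq_square algebra_simps)
  qed
qed

text \<open>Monomials in \<open>z\<close> and \<open>1 + z\<close> with exponents in the hexagon are
  pairwise distinct roots of unity, so \<open>p\<close> is at least the number of its
  points.\<close>

lemma three_term_relation_bound:
  fixes z :: "'k::field"
  assumes z: "Factorial_Ring.prime p" "odd p" "CHAR('k) = 2" "z ^ p = 1" "z \<noteq> 1" "(1 + z) ^ p = 1"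
  shows "3 * (Pocklington.ord p 2)\<^sup>2 \<le> 4 * p"
proof -
  define t where "t = Pocklington.ord p 2"
  define h where "h = (\<lambda>(a, b). z ^ a * (1 + z) ^ b)"
  have "p > 0"
    using z(1) prime_gt_0_nat by blast
  have nz: "z \<noteq> 0" "1 + z \<noteq> 0"
    using z \<open>p > 0\<close> by (auto simp: power_0_left)
  have "inj_on h (hexagon t)"
  proof (rule inj_onI, clarify)
    fix a b c d
    assume H: "(a, b) \<in> hexagon t" "(c, d) \<in> hexagon t" and "h (a, b) = h (c, d)"
    \<comment> \<open>Cancelling common powers leaves truncated differences as exponents, and of
      \<open>a - c\<close> and \<open>c - a\<close> at least one is 0.\<close>
    have split: "z ^ i * (1 + z) ^ j =
        (z ^ min i k * (1 + z) ^ min j l) * (z ^ (i - k) * (1 + z) ^ (j - l))" for i j k l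
    proof -
      have "z ^ i = z ^ min i k * z ^ (i - k)" "(1 + z) ^ j = (1 + z) ^ min j l * (1 + z) ^ (j - l)"
        by (simp_all add: min_def flip: power_add)
      then show ?thesis
        by (simp only: mult_ac)
    qed
    have "z ^ (a - c) * (1 + z) ^ (b - d) = z ^ (c - a) * (1 + z) ^ (d - b)"
      using \<open>h (a, b) = h (c, d)\<close> split[of a b c d] split[of c d a b] nz
      by (simp add: h_def min.commute)
    \<comment> \<open>If the coordinate differences have opposite signs, each sum is a single such
      difference in absolute value; otherwise it is 0 or the absolute difference of the coordinate
      sums.\<close>
    moreover have "(a - c) + (b - d) < t" "(c - a) + (d - b) < t"
    proof -
      have "a < t" "c < t" "b < t" "d < t" "t div 2 \<le> a + b" "t div 2 \<le> c + d"
        "a + b < t div 2 + t" "c + d < t div 2 + t"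
        using H unfolding hexagon_def by auto
      then show "(a - c) + (b - d) < t" "(c - a) + (d - b) < t"
        by linarith+
    qed
    ultimately have "a - c = c - a \<and> b - d = d - b"
      using z by (intro multiplicative_independence[of p z]) (auto simp: t_def)
    then show "a = c \<and> b = d"
      by arith
  qed
  moreover have "h ` hexagon t \<subseteq> {y. y ^ p = 1}"
  proof (clarsimp simp: h_def power_mult_distrib)
    fix a b
    have "(z ^ a) ^ p = (z ^ p) ^ a" "((1 + z) ^ b) ^ p = ((1 + z) ^ p) ^ b"
      by (simp_all add: mult.commute flip: power_mult)
    then show "(z ^ a) ^ p * ((1 + z) ^ b) ^ p = 1"
      using z by simp
  qed
  ultimately have "card (hexagon t) \<le> card {y :: 'k. y ^ p = 1}"
    using roots_of_unity_card(1)[OF \<open>p > 0\<close>] by (rule card_inj_on_le)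
  then have "card (hexagon t) \<le> p"
    using roots_of_unity_card(2)[OF \<open>p > 0\<close>, where 'k='k] by linarith
  then show ?thesis
    using card_hexagon[of t] by (simp add: t_def)
qed

section \<open>Nice subsets\<close>

lemma (in field) prime_characteristic:
  assumes "finite (carrier R)"
  obtains p :: nat where "Factorial_Ring.prime p" "\<And>x. x \<in> carrier R \<Longrightarrow> [p] \<cdot> x = \<zero>"
proof -
  define p where "p = (LEAST n::nat. n > 0 \<and> [n] \<cdot> \<one> = \<zero>)"
  have "[card (carrier R)] \<cdot> \<one> = \<zero>"
    using add.pow_order_eq_1[of \<one>] by (simp add: Coset.order_def)
  moreover have "card (carrier R) > 0"
    using assms zero_closed by (auto simp: card_gt_0_iff)
  ultimately have p: "p > 0 \<and> [p] \<cdot> \<one> = \<zero>"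
    unfolding p_def by (intro LeastI[of "\<lambda>n. n > 0 \<and> [n] \<cdot> \<one> = \<zero>"]) auto
  have least: "[n] \<cdot> \<one> \<noteq> \<zero>" if "0 < n" "n < p" for n :: nat
    using not_less_Least[of n "\<lambda>n. n > 0 \<and> [n] \<cdot> \<one> = \<zero>"] that unfolding p_def by auto
  have "p \<noteq> 1"
    using p by auto
  have "Factorial_Ring.prime p"
  proof (rule ccontr)
    assume "\<not> Factorial_Ring.prime p"
    then obtain a b where "p = a * b" "a \<noteq> 1" "a \<noteq> p"
      using p \<open>p \<noteq> 1\<close> unfolding prime_nat_iff dvd_def by auto
    then have ab: "p = a * b" "0 < a" "a < p" "0 < b" "b < p"
      using p by (auto intro: Nat.gr0I)
    have "[a] \<cdot> \<one> \<otimes> [b] \<cdot> \<one> = [p] \<cdot> \<one>"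
      using ab by (simp add: add_pow_ldistr add.nat_pow_pow mult.commute)
    then show False
      using p integral least[of a] least[of b] ab by auto
  qed
  moreover have "[p] \<cdot> x = \<zero>" if "x \<in> carrier R" for x
  proof -
    have "[p] \<cdot> x = [p] \<cdot> \<one> \<otimes> x"
      using that by (simp add: add_pow_ldistr)
    then show ?thesis
      using p that by simp
  qed
  ultimately show thesis
    using that by blast
qed

lemma CHAR_bit: "CHAR(bit) = 2"
proof (rule CHAR_eqI)
  show "2 dvd n" if "of_nat n = (0 :: bit)" for n
    using that by (metis dvd_0_right even_of_nat)
qed simp

lemma additive_character_add_pow:
  fixes \<chi> :: "'a \<Rightarrow> 'k::comm_monoid_mult"
  assumes "abelian_group R" "\<chi> \<zero>\<^bsub>R\<^esub> = 1"
    and "\<And>x y. x \<in> carrier R \<Longrightarrow> y \<in> carrier R \<Longrightarrow> \<chi> (x \<oplus>\<^bsub>R\<^esub> y) = \<chi> x * \<chi> y"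
    and "x \<in> carrier R"
  shows "\<chi> (add_pow R (n::nat) x) = \<chi> x ^ n"
proof -
  interpret abelian_group R by fact
  show ?thesis
    using assms(2-) by (induction n) (simp_all add: mult.commute)
qed

text \<open>In characteristic 2 the parity condition says that the indicator function of
  \<open>S\<^sub>0\<close> sums to 0 over every translate of \<open>\<beta> S\<^sub>1\<close>. It is
  nonzero because \<open>S\<^sub>0\<close> is nonempty, so an annihilating character exists.\<close>

lemma (in field) algebraically_nice_character:
  assumes fin: "finite (carrier R)" and nice: "algebraically_nice R k S"
  obtains \<chi> :: "'a \<Rightarrow> bit alg_closure" and S\<^sub>1 where "\<chi> \<zero> = 1"
    and "\<And>x y. x \<in> carrier R \<Longrightarrow> y \<in> carrier R \<Longrightarrow> \<chi> (x \<oplus> y) = \<chi> x * \<chi> y"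
    and "S\<^sub>1 \<subseteq> carrier R" "odd (card S\<^sub>1)" "card S\<^sub>1 \<le> k"
    and "\<And>\<beta>. \<beta> \<in> S \<Longrightarrow> (\<Sum>s\<in>S\<^sub>1. \<chi> (\<beta> \<otimes> s)) = 0"
proof -
  obtain S\<^sub>0 S\<^sub>1 where S: "S \<subseteq> carrier R - {\<zero>}" and S1: "S\<^sub>1 \<subseteq> carrier R" "odd (card S\<^sub>1)" "card S\<^sub>1 \<le> k"
    and S0: "S\<^sub>0 \<subseteq> carrier R" "S\<^sub>0 \<noteq> {}"
    and ev: "\<And>\<alpha> \<beta>. \<alpha> \<in> carrier R \<Longrightarrow> \<beta> \<in> S \<Longrightarrow>
               even (card (S\<^sub>0 \<inter> {\<alpha> \<oplus> \<beta> \<otimes> s |s. s \<in> S\<^sub>1}))"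
    using nice unfolding algebraically_nice_def by blast
  have "finite S\<^sub>1"
    using S1 fin finite_subset by blast
  have inj: "inj_on ((\<otimes>) \<beta>) S\<^sub>1" if "\<beta> \<in> S" for \<beta>
    using that S S1 by (intro inj_onI) (auto simp: m_lcancel subset_iff)
  define f :: "'a \<Rightarrow> bit alg_closure" where "f x = of_bool (x \<in> S\<^sub>0)" for x
  define \<B> where "\<B> = (\<lambda>\<beta>. (\<otimes>) \<beta> ` S\<^sub>1) ` S"
  have sum0: "(\<Sum>b\<in>B. f (x \<oplus> b)) = 0" if "B \<in> \<B>" and x: "x \<in> carrier R" for B x
  proof -
    obtain \<beta> where \<beta>: "\<beta> \<in> S" "B = (\<otimes>) \<beta> ` S\<^sub>1"
      using \<open>B \<in> \<B>\<close> by (auto simp: \<B>_def)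
    have B: "B \<subseteq> carrier R" "finite B"
      using \<beta> S S1 \<open>finite S\<^sub>1\<close> by auto
    have "(\<Sum>b\<in>B. f (x \<oplus> b)) = of_nat (card (B \<inter> {b. x \<oplus> b \<in> S\<^sub>0}))"
      using B by (simp add: f_def of_bool_def sum.If_cases)
    also have "card (B \<inter> {b. x \<oplus> b \<in> S\<^sub>0}) = card ((\<oplus>) x ` (B \<inter> {b. x \<oplus> b \<in> S\<^sub>0}))"
      using B x by (intro card_image[symmetric] inj_onI) (auto simp: subset_iff)
    also have "(\<oplus>) x ` (B \<inter> {b. x \<oplus> b \<in> S\<^sub>0}) = S\<^sub>0 \<inter> {x \<oplus> \<beta> \<otimes> s |s. s \<in> S\<^sub>1}"
      unfolding \<beta> by auto
    also have "of_nat (card \<dots>) = (0 :: bit alg_closure)"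
      using ev[OF x \<beta>(1)] by (simp add: of_nat_eq_0_iff_char_dvd CHAR_bit)
    finally show ?thesis .
  qed
  have "comm_group (add_monoid R)"
    by (rule a_comm_group)
  moreover have "B \<subseteq> carrier R" if "B \<in> \<B>" for B
    using that S S1 by (auto simp: \<B>_def)
  moreover have "\<exists>x\<in>carrier R. f x \<noteq> 0"
    using S0 by (auto simp: f_def)
  ultimately obtain \<chi> :: "'a \<Rightarrow> bit alg_closure" where \<chi>: "\<chi> \<zero> = 1"
      "\<And>x y. x \<in> carrier R \<Longrightarrow> y \<in> carrier R \<Longrightarrow> \<chi> (x \<oplus> y) = \<chi> x * \<chi> y"
      "\<And>B. B \<in> \<B> \<Longrightarrow> (\<Sum>b\<in>B. \<chi> b) = 0"
    using comm_group.character_annihilating[of "add_monoid R" \<B> f] fin sum0 by auto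
  show thesis
  proof (rule that[OF \<chi>(1,2) S1])
    fix \<beta> assume "\<beta> \<in> S"
    then show "(\<Sum>s\<in>S\<^sub>1. \<chi> (\<beta> \<otimes> s)) = 0"
      using \<chi>(3)[of "(\<otimes>) \<beta> ` S\<^sub>1"] inj by (simp add: \<B>_def sum.reindex)
  qed
qed

lemma (in field) algebraically_nice_3_structure:
  assumes fin: "finite (carrier R)" and nice: "algebraically_nice R 3 S" and "S \<noteq> {}"
  obtains p :: nat and z :: "bit alg_closure" and l :: "'a \<Rightarrow> int"
  where "Factorial_Ring.prime p" "odd p" "z ^ p = 1" "z \<noteq> 1" "(1 + z) ^ p = 1"
    and "\<And>x y. x \<in> carrier R \<Longrightarrow> y \<in> carrier R \<Longrightarrow> [l (x \<oplus> y) = l x + l y] (mod int p)"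
    and "\<And>\<beta>. \<beta> \<in> S \<Longrightarrow> \<not> int p dvd l \<beta>"
proof -
  have char2: "CHAR(bit alg_closure) = 2"
    by (simp add: CHAR_bit)
  have S: "S \<subseteq> carrier R"
    using nice by (auto simp: algebraically_nice_def)
  obtain \<chi> :: "'a \<Rightarrow> bit alg_closure" and S\<^sub>1 where \<chi>0: "\<chi> \<zero> = 1"
    and \<chi>: "\<And>x y. x \<in> carrier R \<Longrightarrow> y \<in> carrier R \<Longrightarrow> \<chi> (x \<oplus> y) = \<chi> x * \<chi> y"
    and S1: "S\<^sub>1 \<subseteq> carrier R" "odd (card S\<^sub>1)" "card S\<^sub>1 \<le> 3"
    and sum0: "\<And>\<beta>. \<beta> \<in> S \<Longrightarrow> (\<Sum>s\<in>S\<^sub>1. \<chi> (\<beta> \<otimes> s)) = 0"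
    using algebraically_nice_character[OF fin nice] by metis
  obtain p :: nat where p: "Factorial_Ring.prime p" "\<And>x. x \<in> carrier R \<Longrightarrow> [p] \<cdot> x = \<zero>"
    using prime_characteristic[OF fin] by blast
  have "p > 0"
    using p(1) prime_gt_0_nat by blast
  have root: "\<chi> x ^ p = 1" if "x \<in> carrier R" for x
    using additive_character_add_pow[OF abelian_group_axioms, of \<chi> x p] \<chi>0 \<chi> p(2) that by simp
  then have nz: "\<chi> x \<noteq> 0" if "x \<in> carrier R" for x
    using that \<open>p > 0\<close> by (metis zero_neq_one zero_power)
  obtain \<beta>\<^sub>0 where \<beta>\<^sub>0: "\<beta>\<^sub>0 \<in> S"
    using \<open>S \<noteq> {}\<close> by blast
  \<comment> \<open>A single character value is a root of unity and cannot be 0, so the sum must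
    have exactly three terms.\<close>
  have "card S\<^sub>1 \<noteq> 1"
  proof
    assume "card S\<^sub>1 = 1"
    then obtain s where "S\<^sub>1 = {s}"
      by (rule card_1_singletonE)
    then show False
      using sum0[OF \<beta>\<^sub>0] nz[of "\<beta>\<^sub>0 \<otimes> s"] S1 S \<beta>\<^sub>0 by auto
  qed
  moreover have "card S\<^sub>1 = 1 \<or> card S\<^sub>1 = 3"
    using S1(2,3) by presburger
  ultimately have "card S\<^sub>1 = 3"
    by blast
  then obtain s1 s2 s3 where s: "S\<^sub>1 = {s1, s2, s3}" "s1 \<noteq> s2" "s1 \<noteq> s3" "s2 \<noteq> s3"
    unfolding card_3_iff by blast
  \<comment> \<open>Dividing the three-term relation by the value at
    \<open>\<beta> \<otimes> s1\<close> leaves only these differences.\<close>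
  define \<delta> where "\<delta> = s2 \<ominus> s1"
  define \<delta>' where "\<delta>' = s3 \<ominus> s1"
  have carr: "s1 \<in> carrier R" "s2 \<in> carrier R" "s3 \<in> carrier R" "\<delta> \<in> carrier R" "\<delta>' \<in> carrier R"
    using S1 s by (auto simp: \<delta>_def \<delta>'_def)
  have rel: "1 + \<chi> (\<delta> \<otimes> \<beta>) = \<chi> (\<delta>' \<otimes> \<beta>)" if "\<beta> \<in> S" for \<beta>
  proof -
    have \<beta>: "\<beta> \<in> carrier R"
      using that S by auto
    have "\<beta> \<otimes> s2 = \<beta> \<otimes> s1 \<oplus> \<delta> \<otimes> \<beta>" "\<beta> \<otimes> s3 = \<beta> \<otimes> s1 \<oplus> \<delta>' \<otimes> \<beta>"
      using carr \<beta> unfolding \<delta>_def \<delta>'_def by algebra+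
    then have "\<chi> (\<beta> \<otimes> s1) * (1 + \<chi> (\<delta> \<otimes> \<beta>) + \<chi> (\<delta>' \<otimes> \<beta>)) = 0"
      using sum0[OF that] s carr \<beta> by (simp add: \<chi> algebra_simps)
    then have "1 + \<chi> (\<delta> \<otimes> \<beta>) + \<chi> (\<delta>' \<otimes> \<beta>) = 0"
      using nz carr \<beta> by simp
    then show ?thesis
      using uminus_CHAR_2[OF char2] by (metis add_eq_0_iff2)
  qed
  define z where "z = \<chi> (\<delta> \<otimes> \<beta>\<^sub>0)"
  \<comment> \<open>Otherwise \<open>rel\<close> would make the other character value 1 + 1 =
    0.\<close>
  have ne1: "\<chi> (\<delta> \<otimes> \<beta>) \<noteq> 1" if "\<beta> \<in> S" for \<beta>
  proof
    assume "\<chi> (\<delta> \<otimes> \<beta>) = 1"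
    then have "\<chi> (\<delta>' \<otimes> \<beta>) = 0"
      using rel[OF that] uminus_CHAR_2[OF char2, of 1] by (metis add.right_inverse)
    then show False
      using nz carr S that by auto
  qed
  have z: "z ^ p = 1" "z \<noteq> 1" "(1 + z) ^ p = 1"
    using root rel[OF \<beta>\<^sub>0] ne1[OF \<beta>\<^sub>0] carr S \<beta>\<^sub>0 by (auto simp: z_def)
  have "odd p"
  proof
    assume "even p"
    then have "p = 2"
      using p(1) by (metis prime_nat_iff two_is_prime_nat dvd_def primes_dvd_imp_eq)
    then have "(1 + z)\<^sup>2 = 0"
      using char_2_power2_add[OF char2, of 1 z] z(1) uminus_CHAR_2[OF char2, of 1]
      by (metis add.right_inverse power_one)
    then show False
      using z(3) \<open>p = 2\<close> by simp
  qed
  \<comment> \<open>Discrete logarithm to base \<open>z\<close>. It is determined only modulo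
    \<open>p\<close>, hence additivity as a congruence.\<close>
  define l where "l x = int (SOME k. \<chi> (\<delta> \<otimes> x) = z ^ k)" for x
  have l: "\<chi> (\<delta> \<otimes> x) = z ^ nat (l x)" if "x \<in> carrier R" for x
    using someI_ex[OF prime_root_of_unity_generates[OF p(1) z(1,2) root, of "\<delta> \<otimes> x"]] carr that
    by (simp add: l_def)
  show thesis
  proof (rule that[of p z l])
    fix x y assume xy: "x \<in> carrier R" "y \<in> carrier R"
    have "z ^ nat (l (x \<oplus> y)) = z ^ (nat (l x) + nat (l y))"
      using xy carr by (simp add: l[symmetric] power_add r_distr \<chi>)
    then have "[nat (l (x \<oplus> y)) = nat (l x) + nat (l y)] (mod p)"
      using prime_root_of_unity_power_eq_iff[OF p(1) z(1,2)] by blast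
    then show "[l (x \<oplus> y) = l x + l y] (mod int p)"
      by (simp add: l_def flip: cong_int_iff)
  next
    fix \<beta> assume "\<beta> \<in> S"
    then have "z ^ nat (l \<beta>) \<noteq> 1"
      using ne1 S l by (metis subsetD)
    then have "\<not> p dvd nat (l \<beta>)"
      using prime_root_of_unity_power_eq_1_iff[OF p(1) z(1,2)] by blast
    then show "\<not> int p dvd l \<beta>"
      by (simp add: l_def)
  qed (use p \<open>odd p\<close> z in auto)
qed

section \<open>Consequences of combinatorial niceness\<close>

lemma (in field) combinatorially_nice_nonempty:
  assumes "combinatorially_nice R t S" "t \<ge> 1"
  shows "S \<noteq> {}"
proof -
  obtain c :: real where c: "c > 0"
    and vec: "\<And>m. m > 0 \<Longrightarrow> \<exists>u v. \<forall>i\<in>{1..nat \<lfloor>c * real m powr t\<rfloor>}.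
        \<forall>j\<in>{1..nat \<lfloor>c * real m powr t\<rfloor>}. i \<noteq> j \<longrightarrow> dot R m (u j) (v i) \<in> S"
    using assms(1) unfolding combinatorially_nice_def Let_def by metis
  \<comment> \<open>Large enough for two indices; their off-diagonal dot product then lies in
    \<open>S\<close>.\<close>
  define m where "m = nat \<lceil>2 / c\<rceil> + 1"
  have m: "real m \<ge> 1" "real m \<ge> 2 / c" "m > 0"
    by (auto simp: m_def) linarith
  have "2 \<le> c * real m"
    using m c by (simp add: field_simps)
  also have "\<dots> \<le> c * real m powr t"
    using c m assms(2) powr_mono[of 1 t "real m"] by simp
  finally have "2 \<le> nat \<lfloor>c * real m powr t\<rfloor>"
    by linarith
  then have "(1::nat) \<in> {1..nat \<lfloor>c * real m powr t\<rfloor>}" "(2::nat) \<in> {1..nat \<lfloor>c * real m powr t\<rfloor>}"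
    by auto
  then show ?thesis
    using vec[OF \<open>m > 0\<close>] by fastforce
qed

text \<open>For a fixed field the number of matching vectors is O(m^(p-1)), which a family of order
  m^t with t at least \<open>p\<close> outgrows.\<close>

lemma (in field) combinatorially_nice_exponent_less:
  fixes l :: "'a \<Rightarrow> int" and p t :: nat
  assumes fin: "finite (carrier R)" and nice: "combinatorially_nice R (real t) S"
    and p: "Factorial_Ring.prime p"
    and add: "\<And>x y. x \<in> carrier R \<Longrightarrow> y \<in> carrier R \<Longrightarrow> [l (x \<oplus> y) = l x + l y] (mod int p)"
    and S: "\<And>\<beta>. \<beta> \<in> S \<Longrightarrow> \<not> int p dvd l \<beta>"
  shows "t < p"
proof (rule ccontr)
  assume "\<not> t < p"
  define q where "q = card (carrier R)"
  have "[l \<zero> = l \<zero> + l \<zero>] (mod int p)"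
    using add[of \<zero> \<zero>] by simp
  then have l0: "int p dvd l \<zero>"
    by (simp add: cong_iff_dvd_diff)
  obtain c :: real where c: "c > 0"
    and vec: "\<And>m. m > 0 \<Longrightarrow> \<exists>u v.
        (\<forall>i\<in>{1..nat \<lfloor>c * real m powr t\<rfloor>}. u i \<in> vectors R m \<and> v i \<in> vectors R m) \<and>
        (\<forall>i\<in>{1..nat \<lfloor>c * real m powr t\<rfloor>}. dot R m (u i) (v i) = \<zero>) \<and>
        (\<forall>i\<in>{1..nat \<lfloor>c * real m powr t\<rfloor>}. \<forall>j\<in>{1..nat \<lfloor>c * real m powr t\<rfloor>}.
           i \<noteq> j \<longrightarrow> dot R m (u j) (v i) \<in> S)"
    using nice unfolding combinatorially_nice_def Let_def by blast
  \<comment> \<open>The growth estimate divided by m^(p-1). The constant 2 absorbs the loss from the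
    floor and the \<open>Suc\<close> in the bound on \<open>n\<close>.\<close>
  have bound: "c * real m \<le> 2 + real q ^ (p - 1)" if "m > 0" for m
  proof -
    define n where "n = nat \<lfloor>c * real m powr t\<rfloor>"
    obtain u v where uv: "\<And>i. i \<in> {1..n} \<Longrightarrow> u i \<in> vectors R m \<and> v i \<in> vectors R m"
      "\<And>i. i \<in> {1..n} \<Longrightarrow> dot R m (u i) (v i) = \<zero>"
      "\<And>i j. i \<in> {1..n} \<Longrightarrow> j \<in> {1..n} \<Longrightarrow> i \<noteq> j \<Longrightarrow> dot R m (u j) (v i) \<in> S"
      using vec[OF \<open>m > 0\<close>] unfolding n_def[symmetric] by blast
    have "n \<le> Suc ((m * q) ^ (p - 1))"
      unfolding q_def by (rule matching_vectors_bound[OF fin p add, of n u m v]) (use uv l0 S in auto)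
    then have n: "real n \<le> 1 + real m ^ (p - 1) * real q ^ (p - 1)"
      by (metis of_nat_Suc of_nat_le_iff of_nat_mult of_nat_power power_mult_distrib add.commute)
    have "real m ^ (p - 1) * (c * real m) = c * real m ^ p"
      using prime_gt_0_nat[OF p] by (simp add: power_eq_if)
    also have "\<dots> \<le> c * real m ^ t"
      using c \<open>m > 0\<close> \<open>\<not> t < p\<close> by (intro mult_left_mono power_increasing) auto
    also have "\<dots> \<le> 1 + real n"
      using \<open>m > 0\<close> unfolding n_def by (simp add: powr_realpow) linarith
    also have "\<dots> \<le> 2 + real m ^ (p - 1) * real q ^ (p - 1)"
      using n by simp
    also have "\<dots> \<le> real m ^ (p - 1) * (2 + real q ^ (p - 1))"
      using \<open>m > 0\<close> one_le_power[of "real m" "p - 1"] by (simp add: algebra_simps)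
    finally show ?thesis
      using \<open>m > 0\<close> by (simp add: mult_le_cancel_left)
  qed
  define K where "K = (2 + real q ^ (p - 1)) / c"
  have "real (nat \<lceil>K\<rceil> + 1) > K"
    by linarith
  then show False
    using bound[of "nat \<lceil>K\<rceil> + 1"] c by (simp add: K_def field_simps)
qed

theorem theorem25:
  assumes "\<exists>(F :: nat \<Rightarrow> 'a ring) (S :: nat \<Rightarrow> 'a set). nice_sequence 3 F S"
  shows "infinite {t :: nat. t > 0 \<and>
           real (largest_prime_factor (2 ^ t - 1)) \<ge> (3 / 4) * (real t)\<^sup>2}"
  unfolding infinite_nat_iff_unbounded
proof
  fix N :: nat
  obtain F :: "nat \<Rightarrow> 'a ring" and S and t :: "nat \<Rightarrow> int" where
    F: "\<And>i. i \<ge> 1 \<Longrightarrow> Ring.field (F i)" "\<And>i. i \<ge> 1 \<Longrightarrow> finite (carrier (F i))"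
    and t: "strict_mono_on {1..} t"
    and nice: "\<And>i. i \<ge> 1 \<Longrightarrow> algebraically_nice (F i) 3 (S i)"
      "\<And>i. i \<ge> 1 \<Longrightarrow> combinatorially_nice (F i) (real_of_int (t i)) (S i)"
    using assms unfolding nice_sequence_def by blast
  \<comment> \<open>A strictly increasing integer sequence grows at least linearly, whatever the
    sign of \<open>t 1\<close>.\<close>
  have t_ge: "t (Suc i) \<ge> t 1 + int i" for i
  proof (induction i)
    case (Suc i)
    have "t (Suc i) < t (Suc (Suc i))"
      using t by (intro strict_mono_onD[OF t]) auto
    then show ?case
      using Suc by simp
  qed simp
  \<comment> \<open>Chosen so that \<open>p\<close> exceeds \<open>2 ^ N\<close>; as
    \<open>p\<close> divides \<open>2 ^ T - 1\<close>, this will force \<open>T\<close> above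
    \<open>N\<close>.\<close>
  define i where "i = Suc (nat (2 ^ N + 1 - t 1))"
  have ti: "t i \<ge> 2 ^ N + 1" and "i \<ge> 1"
    using t_ge[of "nat (2 ^ N + 1 - t 1)"] by (auto simp: i_def split: if_splits)
  interpret field "F i"
    using F \<open>i \<ge> 1\<close> by blast
  have "t i \<ge> 1"
    using ti by (smt (verit) zero_le_power)
  then have "S i \<noteq> {}"
    using nice(2)[OF \<open>i \<ge> 1\<close>] by (intro combinatorially_nice_nonempty) auto
  then obtain p z l where p: "Factorial_Ring.prime p" "odd p"
    and z: "z ^ p = 1" "z \<noteq> 1" "(1 + z :: bit alg_closure) ^ p = 1"
    and l: "\<And>x y. x \<in> carrier (F i) \<Longrightarrow> y \<in> carrier (F i) \<Longrightarrow>
              [l (x \<oplus>\<^bsub>F i\<^esub> y) = l x + l y] (mod int p)"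
      "\<And>\<beta>. \<beta> \<in> S i \<Longrightarrow> \<not> int p dvd l \<beta>"
    using algebraically_nice_3_structure[OF F(2) nice(1), OF \<open>i \<ge> 1\<close> \<open>i \<ge> 1\<close>] by metis
  have "nat (t i) < p"
    using nice(2)[OF \<open>i \<ge> 1\<close>] \<open>t i \<ge> 1\<close>
    by (intro combinatorially_nice_exponent_less[OF F(2)[OF \<open>i \<ge> 1\<close>] _ p(1) l]) auto
  moreover have "nat (t i) \<ge> 2 ^ N"
    using ti by (simp add: le_nat_iff)
  ultimately have "2 ^ N < p"
    by linarith
  define T where "T = Pocklington.ord p 2"
  have dvd: "p dvd 2 ^ T - 1"
    using ord[of 2 p] unfolding T_def by (subst (asm) cong_altdef_nat) auto
  have "T > 0"
    using p(2) by (simp add: T_def)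
  then have "(2::nat) ^ T > 1"
    by (intro one_less_power) auto
  then have "p < 2 ^ T"
    using dvd_imp_le[OF dvd] by simp
  then have "N < T"
    using \<open>2 ^ N < p\<close> by (metis less_trans one_less_numeral_iff power_less_imp_less_exp semiring_norm(76))
  have "p \<in> prime_factors (2 ^ T - 1)"
    using p(1) dvd \<open>2 ^ T > 1\<close> by (simp add: in_prime_factors_iff)
  then have "p \<le> largest_prime_factor (2 ^ T - 1)"
    unfolding largest_prime_factor_def by (intro Max_ge) auto
  moreover have "3 * T\<^sup>2 \<le> 4 * p"
    unfolding T_def using p z by (intro three_term_relation_bound[of p z]) (auto simp: CHAR_bit)
  ultimately have "3 * T\<^sup>2 \<le> 4 * largest_prime_factor (2 ^ T - 1)"
    by linarith
  then have "real (3 * T\<^sup>2) \<le> real (4 * largest_prime_factor (2 ^ T - 1))"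
    by (simp only: of_nat_le_iff)
  then show "\<exists>n>N. n \<in> {t. t > 0 \<and> real (largest_prime_factor (2 ^ t - 1)) \<ge> (3 / 4) * (real t)\<^sup>2}"
    using \<open>N < T\<close> by (intro exI[of _ T]) auto
qed

end
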